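(* Let $m,r$ be integers such that either $m>0$ and $r>0$, or $m=0$ and $r\ge 0$. Let $h(n,m,\le -r)$ be the number of partitions $\lambda$ of $n$ whose $(2,m)$-rank $r_{2,m}(\lambda)$ is defined and satisfies $r_{2,m}(\lambda)\le -r$, and let $$H_{m,\le -r}(t)=\sum_{n=1}^\infty h(n,m,\le -r)\,t^n .$$ Then, as formal power series in $t$, $$H_{m,\le -r}(t)\;=\;\prod_{n=1}^\infty\frac{1}{1-t^n}\;\sum_{j=1}^\infty(-1)^{j-1}\,t^{\,jr+2jm+j(5j-1)/2}.$$
   Context: A partition $\lambda$ of $n$ is a finite sequence $\lambda_1\ge\dots\ge\lambda_{\ell(\lambda)}>0$ of integers with sum $n$; put $\lambda_j=0$ for $j>\ell(\lambda)$. Its Young diagram $[\lambda]$ has rows of lengths $\lambda_1,\lambda_2,\dots$ from top to bottom. The conjugate partition is denoted $\lambda'$. Let $e(\lambda)=\lambda_{\ell(\lambda)}$ be the smallest part. $\lambda$ is a Rogers-Ramanujan partition if $e(\lambda)\ge\ell(\lambda)$ (the empty partition is counted as Rogers-Ramanujan). Let $\mathcal P$ be the set of all partitions and $\mathcal Q$ the set of Rogers-Ramanujan partitions. For $m\ge 0$, an $m$-rectangle is a rectangle whose height minus its width is $m$. Width $0$ is allowed (such a rectangle always fits) but height $0$ is never allowed. The first $m$-Durfee rectangle of $\lambda$ is the largest $m$-rectangle which fits in $[\lambda]$ (in its top left corner); its height is $s=s_m(\lambda)$. The second $m$-Durfee rectangle is the largest $m$-rectangle which fits in $[\lambda]$ (left-justified)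 directly below the first; its height is $t=t_m(\lambda)$. Explicitly, $s$ is the largest integer $\ge\max(m,1)$ such that $s=m$ or $\lambda_s\ge s-m$, and $t$ is the largest integer $\ge\max(m,1)$ such that $t=m$ or $\lambda_{s+t}\ge t-m$. For $m>0$ both always exist; for $m=0$ both exist exactly when $\lambda\in\mathcal P\smallsetminus\mathcal Q$. Let $\alpha,\beta,\gamma$ be the partitions to the right of the first, to the right of the second (in the middle), and below the second $m$-Durfee rectangle: $\alpha_i=\lambda_i-(s-m)$ for $1\le i\le s$, $\beta_i=\lambda_{s+i}-(t-m)$ for $1\le i\le t$, $\gamma_i=\lambda_{s+t+i}$ for $i\ge 1$ (parts outside these ranges are $0$). The $(2,m)$-rank of $\lambda$ is $$r_{2,m}(\lambda)=\beta_1+\alpha_{s-t-\beta_1+1}-\gamma_1',$$ where $\gamma'_1$ is the number of (nonzero) parts of $\gamma$. It is defined for all $\lambda\in\mathcal P$ if $m>0$, and only for $\lambda\in\mathcal P\smallsetminus\mathcal Q$ if $m=0$. *)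

theory Defs
  imports "HOL-Analysis.Analysis"
begin

section \<open>Partitions\<close>

definition is_partition :: "nat list \<Rightarrow> bool" where
  "is_partition xs \<longleftrightarrow> sorted_wrt (\<ge>) xs \<and> (\<forall>x\<in>set xs. 0 < x)"

definition partitions_of :: "nat \<Rightarrow> nat list set" where
  "partitions_of n = {xs. is_partition xs \<and> sum_list xs = n}"

text \<open>Parts are numbered from 1; only the indices \<open>j \<ge> 1\<close> are meaningful.\<close>

definition part :: "nat list \<Rightarrow> nat \<Rightarrow> nat" where
  "part xs j = (if 1 \<le> j \<and> j \<le> length xs then xs ! (j - 1) else 0)"

definition young_diagram :: "nat list \<Rightarrow> (nat \<times> nat) set" where
  "young_diagram xs = {(i, j). 1 \<le> i \<and> 1 \<le> j \<and> j \<le> part xs i}"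

definition rogers_ramanujan :: "nat list \<Rightarrow> bool" where
  "rogers_ramanujan xs \<longleftrightarrow> is_partition xs \<and> (xs = [] \<or> length xs \<le> last xs)"

section \<open>Durfee rectangles\<close>

text \<open>The left-justified rectangle of height \<open>h\<close> and width \<open>h - m\<close> directly below row \<open>k\<close>
  fits in the diagram. For \<open>h = m\<close> it has width 0 and fits trivially.\<close>

definition rectangle_fits :: "nat \<Rightarrow> nat list \<Rightarrow> nat \<Rightarrow> nat \<Rightarrow> bool" where
  "rectangle_fits m xs k h \<longleftrightarrow>
     1 \<le> h \<and> m \<le> h \<and> {k+1..k+h} \<times> {1..h-m} \<subseteq> young_diagram xs"

text \<open>The next two heights are meaningful only if some \<open>m\<close>-rectangle fits; see
  \<open>rank_defined\<close> and \<open>durfee_rectangles_exist\<close> below.\<close>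

definition durfee1 :: "nat \<Rightarrow> nat list \<Rightarrow> nat" where
  "durfee1 m xs = (GREATEST h. rectangle_fits m xs 0 h)"

definition durfee2 :: "nat \<Rightarrow> nat list \<Rightarrow> nat" where
  "durfee2 m xs = (GREATEST h. rectangle_fits m xs (durfee1 m xs) h)"

section \<open>The rank\<close>

text \<open>In these definitions natural-number subtraction never truncates when the rank is defined;
  see \<open>rank_subtractions_exact\<close> below.\<close>

definition alpha :: "nat \<Rightarrow> nat list \<Rightarrow> nat \<Rightarrow> nat" where
  "alpha m xs i = (let s = durfee1 m xs in
     if 1 \<le> i \<and> i \<le> s then part xs i - (s - m) else 0)"

definition beta :: "nat \<Rightarrow> nat list \<Rightarrow> nat \<Rightarrow> nat" where
  "beta m xs i = (let s = durfee1 m xs; t = durfee2 m xs in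
     if 1 \<le> i \<and> i \<le> t then part xs (s + i) - (t - m) else 0)"

definition gamma :: "nat \<Rightarrow> nat list \<Rightarrow> nat list" where
  "gamma m xs = drop (durfee1 m xs + durfee2 m xs) xs"

definition rank_defined :: "nat \<Rightarrow> nat list \<Rightarrow> bool" where
  "rank_defined m xs \<longleftrightarrow> is_partition xs \<and> (m > 0 \<or> \<not> rogers_ramanujan xs)"

definition rank2 :: "nat \<Rightarrow> nat list \<Rightarrow> int" where
  "rank2 m xs = (let s = durfee1 m xs; t = durfee2 m xs; b = beta m xs 1 in
     int b + int (alpha m xs (s - t - b + 1)) - int (length (gamma m xs)))"

section \<open>Counting\<close>

definition h_le :: "nat \<Rightarrow> nat \<Rightarrow> int \<Rightarrow> nat" where
  "h_le n m a = card {xs \<in> partitions_of n. rank_defined m xs \<and> rank2 m xs \<le> a}"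

text \<open>The generating function runs over \<open>n \<ge> 1\<close>.\<close>

definition H_le :: "nat \<Rightarrow> int \<Rightarrow> rat fps" where
  "H_le m a = Abs_fps (\<lambda>n. if n = 0 then 0 else of_nat (h_le n m a))"

section \<open>Well-definedness\<close>

lemma finite_partitions_of: "finite (partitions_of n)"
proof -
  have "length xs \<le> sum_list xs" if "\<forall>x\<in>set xs. 0 < x" for xs :: "nat list"
    using that by (induction xs) auto
  then have "partitions_of n \<subseteq> {xs. set xs \<subseteq> {..n} \<and> length xs \<le> n}"
    using member_le_sum_list by (fastforce simp: partitions_of_def is_partition_def)
  then show ?thesis
    by (rule finite_subset) (rule finite_lists_length_le, simp)
qed

lemma part_antimono:
  assumes "is_partition xs" "1 \<le> i" "i \<le> j"
  shows "part xs j \<le> part xs i"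
proof (cases "i = j \<or> length xs < j")
  case False
  then show ?thesis
    using assms by (auto simp: part_def is_partition_def sorted_wrt_iff_nth_less)
qed (use assms in \<open>auto simp: part_def\<close>)

lemma part_pos_iff:
  assumes "is_partition xs"
  shows "0 < part xs j \<longleftrightarrow> 1 \<le> j \<and> j \<le> length xs"
  using assms by (auto simp: part_def is_partition_def)

text \<open>The explicit description of the fitting rectangles.\<close>

lemma rectangle_fits_iff:
  assumes "is_partition xs"
  shows "rectangle_fits m xs k h \<longleftrightarrow> max m 1 \<le> h \<and> (h = m \<or> h - m \<le> part xs (k + h))"
    (is "?L \<longleftrightarrow> ?R")
proof
  assume L: ?L
  then have *: "1 \<le> h" "m \<le> h" "{k+1..k+h} \<times> {1..h-m} \<subseteq> young_diagram xs"
    by (auto simp: rectangle_fits_def)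
  have "h - m \<le> part xs (k + h)" if "h \<noteq> m"
  proof -
    have "(k + h, h - m) \<in> {k+1..k+h} \<times> {1..h-m}" using * that by auto
    then have "(k + h, h - m) \<in> young_diagram xs" using *(3) by blast
    then show ?thesis by (simp add: young_diagram_def)
  qed
  then show ?R using * by auto
next
  assume R: ?R
  show ?L
  proof (cases "h = m")
    case False
    have "j \<le> part xs i" if "i \<in> {k+1..k+h}" "j \<in> {1..h-m}" for i j
      using part_antimono[OF assms, of i "k + h"] that R False by auto
    then show ?thesis using R by (auto simp: rectangle_fits_def young_diagram_def)
  qed (use R in \<open>auto simp: rectangle_fits_def\<close>)
qed

lemma rectangle_fits_bounded:
  assumes "is_partition xs" "rectangle_fits m xs k h"
  shows "h \<le> m + length xs"
proof (cases "h = m")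
  case False
  then have "0 < part xs (k + h)"
    using assms rectangle_fits_iff[OF assms(1), of m k h] by auto
  then show ?thesis using part_pos_iff[OF assms(1)] by auto
qed auto

lemma rectangle_fits_Greatest:
  assumes "is_partition xs" "rectangle_fits m xs k h0"
  shows "rectangle_fits m xs k (GREATEST h. rectangle_fits m xs k h)"
    and "rectangle_fits m xs k h \<Longrightarrow> h \<le> (GREATEST h. rectangle_fits m xs k h)"
  using GreatestI_nat[of "rectangle_fits m xs k" h0 "m + length xs"]
    Greatest_le_nat[of "rectangle_fits m xs k" h "m + length xs"]
    rectangle_fits_bounded[OF assms(1)] assms(2) by blast+

lemma part_last:
  assumes "xs \<noteq> []"
  shows "part xs (length xs) = last xs"
  using assms by (cases "length xs") (auto simp: part_def last_conv_nth)

lemma durfee1_exists: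
  assumes "is_partition xs" "m > 0 \<or> xs \<noteq> []"
  shows "\<exists>h. rectangle_fits m xs 0 h"
proof (cases "m > 0")
  case True
  then show ?thesis by (intro exI[of _ m]) (simp add: rectangle_fits_iff[OF assms(1)])
next
  case False
  then have "0 < part xs 1" using assms part_pos_iff[OF assms(1)] by (cases xs) auto
  then show ?thesis
    using False by (intro exI[of _ 1]) (simp add: rectangle_fits_iff[OF assms(1)])
qed

text \<open>For \<open>m > 0\<close> both Durfee rectangles always exist; for \<open>m = 0\<close> they both exist
  exactly when the partition is not a Rogers-Ramanujan partition.\<close>

lemma durfee_rectangles_exist:
  assumes "is_partition xs"
  shows "rank_defined m xs \<longleftrightarrow>
    (\<exists>h. rectangle_fits m xs 0 h) \<and> (\<exists>h. rectangle_fits m xs (durfee1 m xs) h)"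
proof (cases "m > 0")
  case True
  then have "rectangle_fits m xs k m" for k
    by (simp add: rectangle_fits_iff[OF assms])
  then show ?thesis using True assms by (auto simp: rank_defined_def)
next
  case False
  then have m: "m = 0" by simp
  show ?thesis
  proof (cases "xs = []")
    case True
    then have "\<not> rectangle_fits m xs 0 h" for h
      using m part_pos_iff[OF assms, of h] rectangle_fits_iff[OF assms, of m 0 h] by auto
    then show ?thesis
      using True m assms by (auto simp: rank_defined_def rogers_ramanujan_def)
  next
    case False
    then obtain h0 where h0: "rectangle_fits m xs 0 h0" using durfee1_exists assms by blast
    define s where "s = durfee1 m xs"
    have s: "rectangle_fits m xs 0 s" "\<And>h. rectangle_fits m xs 0 h \<Longrightarrow> h \<le> s"
      unfolding s_def durfee1_def using rectangle_fits_Greatest[OF assms h0] by auto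
    have s': "1 \<le> s" "s \<le> part xs s" using s(1) m by (auto simp: rectangle_fits_iff[OF assms])
    have sl: "s \<le> length xs"
      using part_pos_iff[OF assms, of s] s' by auto
    have "(\<exists>h. rectangle_fits m xs s h) \<longleftrightarrow> s < length xs"
    proof
      assume "\<exists>h. rectangle_fits m xs s h"
      then obtain h where "1 \<le> h" "h \<le> part xs (s + h)"
        using m by (auto simp: rectangle_fits_iff[OF assms])
      then show "s < length xs" using part_pos_iff[OF assms, of "s + h"] by auto
    next
      assume "s < length xs"
      then have "0 < part xs (s + 1)" using part_pos_iff[OF assms] by auto
      then show "\<exists>h. rectangle_fits m xs s h"
        using m by (intro exI[of _ 1]) (simp add: rectangle_fits_iff[OF assms])
    qed
    moreover have "rogers_ramanujan xs \<longleftrightarrow> s = length xs"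
    proof
      assume "rogers_ramanujan xs"
      then have "rectangle_fits m xs 0 (length xs)"
        using False m
        by (auto simp: rogers_ramanujan_def rectangle_fits_iff[OF assms] part_last Suc_le_eq)
      then show "s = length xs" using s(2) sl by force
    next
      assume "s = length xs"
      then show "rogers_ramanujan xs"
        using s' False assms part_last[OF False] by (simp add: rogers_ramanujan_def)
    qed
    ultimately show ?thesis
      unfolding rank_defined_def s_def[symmetric] using h0 sl m assms by auto
  qed
qed

text \<open>No subtraction in the definition of the rank truncates, and the index of the part of
  \<open>alpha\<close> in it lies in the range \<open>{1..s}\<close>.\<close>

lemma rank_subtractions_exact:
  assumes "rank_defined m xs"
  defines "s \<equiv> durfee1 m xs" and "t \<equiv> durfee2 m xs"
  shows "m \<le> s" "m \<le> t"
    and "i \<in> {1..s} \<Longrightarrow> s - m \<le> part xs i"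
    and "i \<in> {1..t} \<Longrightarrow> t - m \<le> part xs (s + i)"
    and "t + beta m xs 1 \<le> s"
    and "s - t - beta m xs 1 + 1 \<in> {1..s}"
proof -
  have p: "is_partition xs" using assms(1) by (simp add: rank_defined_def)
  obtain h1 h2 where h: "rectangle_fits m xs 0 h1" "rectangle_fits m xs s h2"
    using durfee_rectangles_exist[OF p] assms(1) unfolding s_def by blast
  have s: "rectangle_fits m xs 0 s" "\<And>h. rectangle_fits m xs 0 h \<Longrightarrow> h \<le> s"
    unfolding s_def durfee1_def using rectangle_fits_Greatest[OF p h(1)] by auto
  have t: "rectangle_fits m xs s t"
    unfolding t_def durfee2_def s_def[symmetric]
    using rectangle_fits_Greatest(1)[OF p h(2)] by auto
  have s': "1 \<le> s" "m \<le> s" "s - m \<le> part xs s"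
    and t': "1 \<le> t" "m \<le> t" "t - m \<le> part xs (s + t)"
    using s(1) t by (auto simp: rectangle_fits_iff[OF p])
  show "m \<le> s" "m \<le> t" using s' t' by auto
  show "s - m \<le> part xs i" if "i \<in> {1..s}"
    using part_antimono[OF p, of i s] s' that by auto
  show b: "t - m \<le> part xs (s + i)" if "i \<in> {1..t}" for i
    using part_antimono[OF p, of "s + i" "s + t"] t' that by auto
  have "\<not> rectangle_fits m xs 0 (s + 1)" using s(2)[of "s + 1"] by auto
  then have "part xs (s + 1) < s + 1 - m"
    using s' by (auto simp: rectangle_fits_iff[OF p])
  moreover have "beta m xs 1 = part xs (s + 1) - (t - m)"
    using t' by (simp add: beta_def s_def t_def Let_def)
  moreover have "t - m \<le> part xs (s + 1)" using b[of 1] t' by auto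
  ultimately show le: "t + beta m xs 1 \<le> s" using s' t' by linarith
  show "s - t - beta m xs 1 + 1 \<in> {1..s}" using le t' by auto
qed

lemma LIMSEQ_fps_stabilizing:
  fixes F :: "nat \<Rightarrow> rat fps"
  assumes "\<And>N k. k \<le> N \<Longrightarrow> fps_nth (F (Suc N)) k = fps_nth (F N) k"
  shows "F \<longlonglongrightarrow> Abs_fps (\<lambda>k. fps_nth (F k) k)"
proof (rule tendsto_fpsI)
  fix k
  have "fps_nth (F N) k = fps_nth (F k) k" if "k \<le> N" for N
    using that by (induction N rule: dec_induct) (simp_all add: assms)
  then show "eventually (\<lambda>N. fps_nth (F N) k = fps_nth (Abs_fps (\<lambda>k. fps_nth (F k) k)) k) sequentially"
    unfolding eventually_sequentially fps_nth_Abs_fps by blast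
qed

text \<open>The infinite product and the infinite sum of the theorem converge in the topology of
  formal power series, so that \<open>prodinf\<close> and \<open>suminf\<close> denote their limits.\<close>

lemma convergent_euler_product:
  "convergent_prod (\<lambda>i. let n = i + 1 in 1 / (1 - fps_X ^ n) :: rat fps)"
proof -
  define f :: "nat \<Rightarrow> rat fps" where "f i = (let n = i + 1 in 1 / (1 - fps_X ^ n))" for i
  define P where "P N = (\<Prod>i\<le>N. f i)" for N
  have f: "f i * (1 - fps_X ^ (i + 1)) = 1" for i
    unfolding f_def Let_def by (simp add: fps_divide_unit inverse_mult_eq_1)
  have "fps_nth (P (Suc N)) k = fps_nth (P N) k" if "k \<le> N" for N k
  proof -
    have "P N = P N * (f (Suc N) * (1 - fps_X ^ (Suc N + 1)))" by (simp only: f mult_1_right)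
    also have "\<dots> = P (Suc N) - fps_X ^ (Suc N + 1) * P (Suc N)"
      by (simp add: P_def algebra_simps)
    finally have "fps_nth (P N) k =
        fps_nth (P (Suc N)) k - fps_nth (fps_X ^ (Suc N + 1) * P (Suc N)) k"
      by (metis fps_sub_nth)
    moreover have "fps_nth (fps_X ^ (Suc N + 1) * P (Suc N)) k = 0"
      unfolding fps_X_power_mult_nth using that by simp
    ultimately show ?thesis by simp
  qed
  then have "P \<longlonglongrightarrow> Abs_fps (\<lambda>k. fps_nth (P k) k)" by (rule LIMSEQ_fps_stabilizing)
  moreover have "fps_nth (P 0) 0 \<noteq> 0"
    using arg_cong[OF f[of 0], of "\<lambda>g. fps_nth g 0"] by (auto simp: P_def)
  then have "Abs_fps (\<lambda>k. fps_nth (P k) k) \<noteq> 0"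
    unfolding fps_eq_iff by (auto intro!: exI[of _ 0])
  ultimately have "raw_has_prod f 0 (Abs_fps (\<lambda>k. fps_nth (P k) k))"
    by (simp add: raw_has_prod_def P_def[abs_def])
  then show ?thesis unfolding convergent_prod_def f_def by blast
qed

lemma summable_rank_series:
  "summable (\<lambda>i. let j = i + 1 in
     (-1) ^ (j - 1) * fps_X ^ (j * r + 2 * j * m + j * (5 * j - 1) div 2) :: rat fps)"
proof -
  define e where "e j = j * r + 2 * j * m + j * (5 * j - 1) div 2" for j :: nat
  define g :: "nat \<Rightarrow> rat fps" where "g i = (-1) ^ i * fps_X ^ e (i + 1)" for i
  have e: "i < e (i + 1)" for i
  proof -
    have "i + 1 = (i + 1) * 2 div 2" by (rule nonzero_mult_div_cancel_right[symmetric]) simp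
    also have "\<dots> \<le> (i + 1) * (5 * (i + 1) - 1) div 2"
      by (intro div_le_mono mult_le_mono) auto
    also have "\<dots> \<le> e (i + 1)" unfolding e_def by (rule le_add2)
    finally show ?thesis by (simp only: Suc_eq_plus1[symmetric] Suc_le_eq)
  qed
  have "fps_nth (g N) k = 0" if "k \<le> N" for N k
    using e[of N] that unfolding g_def fps_X_power_mult_right_nth by simp
  then have "fps_nth (\<Sum>i<Suc N. g i) k = fps_nth (\<Sum>i<N. g i) k" if "k \<le> N" for N k
    using that by simp
  then have "(\<lambda>N. \<Sum>i<N. g i) \<longlonglongrightarrow> Abs_fps (\<lambda>k. fps_nth (\<Sum>i<k. g i) k)"
    by (rule LIMSEQ_fps_stabilizing)
  then have "summable g" unfolding summable_def sums_def by blast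
  then show ?thesis unfolding g_def e_def Let_def add_diff_cancel_right' .
qed

end

(* Cut along its two m-Durfee rectangles, a partition with defined rank becomes a triple (A, B, C):
   the rows to the right of the first rectangle, padded with zeros to its height s; those to the
   right of the second, padded to its height t; and the partition below. The rectangles being
   maximal amounts to t + hd B <= s and to the parts of C being at most t - m.

   The rank is a - (number of parts of C), where a is the sum of hd B and the part of A at
   index s - t - hd B (counted from 0). Starting from a triple for m + 2 of rank >= -r, delete
   these two parts and give C a new first column of height a + r. This makes both rectangles one
   row shorter and one column wider and yields a triple for m of rank <= -r. Conversely, for a
   given a at least as large as the selected sum of the shorter lists, there is exactly one place
   where two parts of sum a can be inserted so that they are selected again. Counting sizes,
       H_{m,<=-r} = X^(r+2m+2) * (P - H_{m+2,<=-(r+1)}),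
   with P the generating function of all partitions, and iterating gives the alternating sum. *)
theory Submission
  imports Defs
begin

section \<open>The generating function of partitions\<close>

text \<open>A partition with parts at most \<open>Suc N\<close> either has no part
  \<open>Suc N\<close> or begins with one, which can be removed. Multiplying by
  \<open>1 - fps_X ^ Suc N\<close> therefore lowers the bound to \<open>N\<close>.\<close>

lemma partitions_gf_bounded:
  "Abs_fps (\<lambda>n. of_nat (card {xs \<in> partitions_of n. \<forall>x\<in>set xs. x \<le> N}) :: rat) *
   (\<Prod>i<N. 1 - fps_X ^ (i + 1)) = 1"
proof (induction N)
  case 0
  have empty: "is_partition xs \<and> (\<forall>x\<in>set xs. x \<le> 0) \<longleftrightarrow> xs = []" for xs
    by (cases xs) (auto simp: is_partition_def)
  have "card {xs \<in> partitions_of n. \<forall>x\<in>set xs. x \<le> 0} = card (if n = 0 then {[] :: nat list} else {})" for n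
  proof (rule arg_cong[of _ _ card])
    have "{xs \<in> partitions_of n. \<forall>x\<in>set xs. x \<le> 0} = {xs. xs = [] \<and> sum_list xs = n}"
      unfolding partitions_of_def
      by (intro Collect_cong) (simp only: mem_Collect_eq empty[symmetric] conj_ac)
    also have "\<dots> = (if n = 0 then {[]} else {})"
      by auto
    finally show "{xs \<in> partitions_of n. \<forall>x\<in>set xs. x \<le> 0} = (if n = 0 then {[]} else {})" .
  qed
  then show ?case by (simp add: fps_eq_iff)
next
  case (Suc N)
  define Q where "Q N n = {xs \<in> partitions_of n. \<forall>x\<in>set xs. x \<le> N}" for N n
  define F where "F N = Abs_fps (\<lambda>n. of_nat (card (Q N n)) :: rat)" for N
  have fin: "finite (Q N n)" for N n
    by (rule finite_subset[OF _ finite_partitions_of[of n]]) (auto simp: Q_def)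
  have Q_Suc: "Q (Suc N) n = Q N n \<union> (if Suc N \<le> n then Cons (Suc N) ` Q (Suc N) (n - Suc N) else {})"
    (is "_ = ?R n") for n
  proof (intro subset_antisym subsetI)
    fix xs assume xs: "xs \<in> Q (Suc N) n"
    show "xs \<in> ?R n"
    proof (cases "\<forall>x\<in>set xs. x \<le> N")
      case True
      then show ?thesis using xs by (auto simp: Q_def)
    next
      case False
      then obtain y ys where "xs = y # ys" by (cases xs) auto
      \<comment> \<open>The first part is the largest, so it must be the one exceeding
        \<open>N\<close>.\<close>
      moreover from this have "y = Suc N"
        using False xs by (fastforce simp: Q_def partitions_of_def is_partition_def)
      ultimately show ?thesis
        using xs by (auto simp: Q_def partitions_of_def is_partition_def)
    qed
  next
    fix xs assume "xs \<in> ?R n"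
    then show "xs \<in> Q (Suc N) n"
      by (fastforce simp: Q_def partitions_of_def is_partition_def split: if_splits)
  qed
  have "card (Q (Suc N) n) = card (Q N n) + (if Suc N \<le> n then card (Q (Suc N) (n - Suc N)) else 0)" for n
  proof -
    have "Q N n \<inter> Cons (Suc N) ` Q (Suc N) (n - Suc N) = {}"
      by (auto simp: Q_def)
    then show ?thesis
      unfolding Q_Suc[of n] by (auto simp: card_Un_disjoint fin card_image)
  qed
  then have "F (Suc N) = F N + fps_X ^ Suc N * F (Suc N)"
    by (auto simp: fps_eq_iff F_def fps_X_power_mult_nth simp del: power_Suc)
  then have "F (Suc N) * (1 - fps_X ^ Suc N) = F N"
    by (simp add: algebra_simps del: power_Suc)
  then have "F (Suc N) * (\<Prod>i<Suc N. 1 - fps_X ^ (i + 1)) = F N * (\<Prod>i<N. 1 - fps_X ^ (i + 1))"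
    by (simp add: mult_ac del: power_Suc)
  then show ?case using Suc unfolding F_def Q_def by (simp only:)
qed

text \<open>A bound on the parts is no restriction on partitions of \<open>n\<close> once it reaches
  \<open>n\<close>, so each coefficient of the finite products is eventually the full count.\<close>

lemma euler_partition_product:
  "(\<Prod>i. let n = i + 1 in 1 / (1 - fps_X ^ n)) = Abs_fps (\<lambda>n. of_nat (card (partitions_of n)) :: rat)"
proof -
  define f :: "nat \<Rightarrow> rat fps" where "f i = (let n = i + 1 in 1 / (1 - fps_X ^ n))" for i
  define F where "F N = Abs_fps (\<lambda>n. of_nat (card {xs \<in> partitions_of n. \<forall>x\<in>set xs. x \<le> N}) :: rat)" for N
  have f: "(1 - fps_X ^ (i + 1)) * f i = 1" for i
    unfolding f_def Let_def by (simp add: fps_divide_unit inverse_mult_eq_1')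
  have "(\<Prod>i\<le>N. f i) = F (Suc N)" for N
  proof -
    have "F (Suc N) * ((\<Prod>i<Suc N. 1 - fps_X ^ (i + 1)) * (\<Prod>i<Suc N. f i)) = (\<Prod>i<Suc N. f i)"
      unfolding F_def mult.assoc[symmetric] partitions_gf_bounded by simp
    then show ?thesis
      unfolding prod.distrib[symmetric] f by (simp add: lessThan_Suc_atMost)
  qed
  moreover have "(\<lambda>N. F (Suc N)) \<longlonglongrightarrow> Abs_fps (\<lambda>n. of_nat (card (partitions_of n)))"
  proof (rule tendsto_fpsI)
    fix n
    have "{xs \<in> partitions_of n. \<forall>x\<in>set xs. x \<le> Suc N} = partitions_of n" if "n \<le> N" for N
      using that member_le_sum_list by (fastforce simp: partitions_of_def)
    then show "\<forall>\<^sub>F N in sequentially.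
        fps_nth (F (Suc N)) n = fps_nth (Abs_fps (\<lambda>n. of_nat (card (partitions_of n)))) n"
      unfolding eventually_sequentially F_def by (intro exI[of _ n]) simp
  qed
  \<comment> \<open>\<open>raw_has_prod\<close> demands a nonzero limit; the empty partition makes
    the constant coefficient nonzero.\<close>
  moreover have "[] \<in> partitions_of 0"
    by (simp add: partitions_of_def is_partition_def)
  then have "card (partitions_of 0) \<noteq> 0"
    using finite_partitions_of[of 0] by auto
  then have "Abs_fps (\<lambda>n. of_nat (card (partitions_of n)) :: rat) \<noteq> 0"
    by (auto simp: fps_eq_iff intro!: exI[of _ 0])
  ultimately have "f has_prod Abs_fps (\<lambda>n. of_nat (card (partitions_of n)))"
    by (simp add: has_prod_def raw_has_prod_def)
  then show ?thesis unfolding f_def by (rule has_prod_unique[symmetric])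
qed

section \<open>Cutting a partition along its Durfee rectangles\<close>

lemma is_partition_filter_pos: "sorted_wrt (\<ge>) xs \<Longrightarrow> is_partition (filter ((<) 0) xs)"
  by (auto simp: is_partition_def sorted_wrt_filter)

text \<open>The zeros of a weakly decreasing list form a tail, and \<open>part\<close> is 0 beyond
  the end anyway.\<close>

lemma part_filter_pos:
  assumes "sorted_wrt (\<ge>) xs"
  shows "part (filter ((<) 0) xs) i = part xs i"
  using assms
proof (induction xs arbitrary: i)
  case (Cons x xs)
  show ?case
  proof (cases "x = 0")
    case True
    then have "filter ((<) 0) (x # xs) = []" "\<forall>y\<in>set (x # xs). y = 0"
      using Cons.prems by (auto simp: filter_empty_conv)
    then show ?thesis by (auto simp: part_def nth_Cons')
  next
    case False
    then show ?thesis using Cons.IH[of "i - 1"] Cons.prems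
      by (auto simp: part_def nth_Cons' split: if_splits)
  qed
qed (simp add: part_def)

text \<open>Positivity lets the length be read off from which parts are nonzero.\<close>

lemma partition_eqI:
  assumes "is_partition xs" "is_partition ys" "\<And>i. 1 \<le> i \<Longrightarrow> part xs i = part ys i"
  shows "xs = ys"
proof (rule nth_equalityI)
  have "1 \<le> i \<and> i \<le> length xs \<longleftrightarrow> 1 \<le> i \<and> i \<le> length ys" for i
    using assms(3)[of i] part_pos_iff[OF assms(1), of i] part_pos_iff[OF assms(2), of i] by (metis le0 not_less_eq_eq One_nat_def)
  then show len: "length xs = length ys"
    by (metis One_nat_def Suc_leI antisym le_refl le_zero_eq not_less)
  show "xs ! i = ys ! i" if "i < length xs" for i
    using assms(3)[of "Suc i"] that len by (simp add: part_def)
qed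

lemma filter_pos_append_replicate_zero:
  "is_partition xs \<Longrightarrow> filter ((<) 0) (xs @ replicate k 0) = xs"
  by (auto simp: is_partition_def filter_id_conv)

lemma part_append: "part (xs @ ys) i = (if i \<le> length xs then part xs i else part ys (i - length xs))"
  by (auto simp: part_def nth_append)

lemma part_map: "1 \<le> i \<Longrightarrow> i \<le> length xs \<Longrightarrow> part (map f xs) i = f (part xs i)"
  by (auto simp: part_def)

lemma part_drop: "1 \<le> i \<Longrightarrow> part (drop k xs) i = part xs (k + i)"
  by (auto simp: part_def)

lemma part_hd: "xs \<noteq> [] \<Longrightarrow> part xs 1 = hd xs"
  by (cases xs) (auto simp: part_def)

text \<open>\<open>A\<close> and \<open>B\<close> keep their zeros, so that their lengths are the
  heights of the two rectangles. The inequalities are written with sums to avoid truncated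
  subtraction.\<close>

definition durfee_data :: "nat \<Rightarrow> (nat list \<times> nat list \<times> nat list) set" where
  "durfee_data m = {(A, B, C). sorted_wrt (\<ge>) A \<and> sorted_wrt (\<ge>) B \<and> is_partition C \<and>
     1 \<le> length B \<and> m \<le> length B \<and> length B + hd B \<le> length A \<and>
     (\<forall>x\<in>set C. x + m \<le> length B)}"

definition stack :: "nat \<Rightarrow> nat list \<times> nat list \<times> nat list \<Rightarrow> nat list" where
  "stack m = (\<lambda>(A, B, C).
     map (\<lambda>x. x + (length A - m)) A @ map (\<lambda>x. x + (length B - m)) B @ C)"

text \<open>The stack contains zeros only if a rectangle has width 0; these are not parts and must
  go.\<close>

definition assemble :: "nat \<Rightarrow> nat list \<times> nat list \<times> nat list \<Rightarrow> nat list" where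
  "assemble m T = filter ((<) 0) (stack m T)"

text \<open>List positions count from 0, so the index in the rank formula loses its
  \<open>+ 1\<close>.\<close>

definition selected_sum :: "nat list \<Rightarrow> nat list \<Rightarrow> nat" where
  "selected_sum A B = hd B + A ! (length A - length B - hd B)"

definition data_rank :: "nat list \<times> nat list \<times> nat list \<Rightarrow> int" where
  "data_rank = (\<lambda>(A, B, C). int (selected_sum A B) - int (length C))"

definition data_weight :: "nat \<Rightarrow> nat list \<times> nat list \<times> nat list \<Rightarrow> nat" where
  "data_weight m = (\<lambda>(A, B, C). sum_list A + sum_list B + sum_list C +
     length A * (length A - m) + length B * (length B - m))"

section \<open>The correspondence between triples and partitions\<close>

lemma sorted_hd_ge: "sorted_wrt (\<ge>) xs \<Longrightarrow> x \<in> set xs \<Longrightarrow> x \<le> hd (xs :: nat list)"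
  by (cases xs) auto

text \<open>Order can fail only at the seams between the blocks, and there the two maximality
  conditions of \<open>durfee_data\<close> give the needed comparisons.\<close>

lemma sorted_stack:
  assumes "T \<in> durfee_data m"
  shows "sorted_wrt (\<ge>) (stack m T)"
proof -
  obtain A B C where T: "T = (A, B, C)" by (cases T)
  have *: "sorted_wrt (\<ge>) A" "sorted_wrt (\<ge>) B" "is_partition C"
    "1 \<le> length B" "m \<le> length B" "length B + hd B \<le> length A"
    "\<And>x. x \<in> set C \<Longrightarrow> x + m \<le> length B"
    using assms by (auto simp: durfee_data_def T)
  define v w where "v = length A - m" and "w = length B - m"
  have "y + w \<le> x + v" if "y \<in> set B" for x y
    using sorted_hd_ge[OF *(2) that] *(5,6) unfolding v_def w_def by linarith
  moreover have "z \<le> x + v" "z \<le> x + w" if "z \<in> set C" for x z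
    using *(7)[OF that] *(5,6) unfolding v_def w_def by linarith+
  ultimately show ?thesis
    unfolding T stack_def prod.case v_def[symmetric] w_def[symmetric]
    using *(1-3) by (auto simp: sorted_wrt_append sorted_wrt_map is_partition_def)
qed

text \<open>The row just below each rectangle is no longer than the rectangle is wide, so no larger
  \<open>m\<close>-rectangle fits. Once both heights are known, the remaining data can be read off
  from the parts.\<close>

lemma assemble_props:
  assumes T: "(A, B, C) \<in> durfee_data m"
  defines "xs \<equiv> assemble m (A, B, C)"
  shows "is_partition xs" "rank_defined m xs"
    and "durfee1 m xs = length A" "durfee2 m xs = length B"
    and "i \<in> {1..length A} \<Longrightarrow> alpha m xs i = part A i"
    and "i \<in> {1..length B} \<Longrightarrow> beta m xs i = part B i"
    and "gamma m xs = C"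
    and "sum_list xs = data_weight m (A, B, C)"
    and "rank2 m xs = data_rank (A, B, C)"
proof -
  define s t where "s = length A" and "t = length B"
  note len = s_def[symmetric] t_def[symmetric]
  have *: "sorted_wrt (\<ge>) A" "sorted_wrt (\<ge>) B" "is_partition C"
    "1 \<le> t" "m \<le> t" "t + hd B \<le> s" "\<And>x. x \<in> set C \<Longrightarrow> x + m \<le> t"
    using T unfolding durfee_data_def mem_Collect_eq prod.case len by auto
  have B: "B \<noteq> []" using *(4) by (auto simp: t_def)
  have p: "is_partition xs"
    unfolding xs_def assemble_def by (intro is_partition_filter_pos sorted_stack[OF T])
  have part_xs: "part xs i = part (stack m (A, B, C)) i" for i
    unfolding xs_def assemble_def by (intro part_filter_pos sorted_stack[OF T])
  have part1: "part xs i = part A i + (s - m)" if "i \<in> {1..s}" for i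
    using that by (simp add: part_xs stack_def part_append part_map len)
  have part2: "part xs (s + i) = part B i + (t - m)" if "i \<in> {1..t}" for i
    using that by (simp add: part_xs stack_def part_append part_map len)
  have part3: "part xs (s + t + i) = part C i" if "1 \<le> i" for i
    using that by (simp add: part_xs stack_def part_append len)
  have "part xs (s + 1) = hd B + (t - m)"
    using part2[of 1] part_hd[OF B] *(4) by simp
  then have part21: "part xs (s + 1) \<le> s - m"
    using *(5,6) by linarith
  have part31: "part xs (s + t + 1) \<le> t - m"
  proof (cases "C = []")
    case True
    then show ?thesis using part3[of 1] by (simp add: part_def)
  next
    case False
    then show ?thesis using part3[of 1] part_hd[OF False] *(7)[of "hd C"] by simp
  qed
  have fits1: "rectangle_fits m xs 0 s"
    using * part1[of s] by (auto simp: rectangle_fits_iff[OF p])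
  have s: "durfee1 m xs = s"
    unfolding durfee1_def
  proof (rule Greatest_equality[of "rectangle_fits m xs 0", OF fits1])
    fix h assume h: "rectangle_fits m xs 0 h"
    show "h \<le> s"
    proof (rule ccontr)
      assume "\<not> h \<le> s"
      then have "part xs h \<le> s - m"
        using part_antimono[OF p, of "s + 1" h] part21 by linarith
      then show False
        using h \<open>\<not> h \<le> s\<close> * by (auto simp: rectangle_fits_iff[OF p])
    qed
  qed
  have fits2: "rectangle_fits m xs s t"
    using * part2[of t] by (auto simp: rectangle_fits_iff[OF p])
  have t: "durfee2 m xs = t"
    unfolding durfee2_def s
  proof (rule Greatest_equality[of "rectangle_fits m xs s", OF fits2])
    fix h assume h: "rectangle_fits m xs s h"
    show "h \<le> t"
    proof (rule ccontr)
      assume "\<not> h \<le> t"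
      then have "part xs (s + h) \<le> t - m"
        using part_antimono[OF p, of "s + t + 1" "s + h"] part31 by linarith
      then show False
        using h \<open>\<not> h \<le> t\<close> * by (auto simp: rectangle_fits_iff[OF p])
    qed
  qed
  show "is_partition xs" by (rule p)
  show "rank_defined m xs"
    using durfee_rectangles_exist[OF p] fits1 fits2 s by auto
  show "durfee1 m xs = length A" "durfee2 m xs = length B"
    using s t by (simp_all add: s_def t_def)
  show alpha: "alpha m xs i = part A i" if "i \<in> {1..length A}" for i
    using that part1[of i] s by (simp add: alpha_def s_def t_def)
  show beta: "beta m xs i = part B i" if "i \<in> {1..length B}" for i
    using that part2[of i] s t by (simp add: beta_def s_def t_def)
  \<comment> \<open>If the second rectangle has width 0, filtering may delete rows above
    \<open>C\<close>, but then \<open>C\<close> is empty. Otherwise nothing is deleted.\<close>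
  show C: "gamma m xs = C"
  proof (cases "t = m")
    case True
    then have "C = []" using *(3,7) by (cases C) (auto simp: is_partition_def)
    then have "length (stack m (A, B, C)) = s + t"
      by (simp add: stack_def len)
    then have "length xs \<le> s + t"
      using length_filter_le[of "(<) 0" "stack m (A, B, C)"] by (simp add: xs_def assemble_def)
    then show ?thesis using \<open>C = []\<close> by (simp add: gamma_def s t)
  next
    case False
    then have "0 < s - m" "0 < t - m" using * by auto
    then have "xs = stack m (A, B, C)"
      unfolding xs_def assemble_def using *(3)
      by (intro filter_True) (auto simp: stack_def s_def t_def is_partition_def)
    then show ?thesis unfolding gamma_def s t by (simp add: stack_def s_def t_def)
  qed
  have "sum_list (filter ((<) 0) ys) = sum_list ys" for ys :: "nat list"
    by (induction ys) auto
  then show "sum_list xs = data_weight m (A, B, C)"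
    by (simp add: xs_def assemble_def stack_def data_weight_def sum_list_addf sum_list_triv)
  have b: "beta m xs 1 = hd B" using beta[of 1] part_hd[OF B] *(4) by (simp add: len)
  have "alpha m xs (s - t - hd B + 1) = part A (s - t - hd B + 1)"
    using * by (intro alpha) (auto simp: s_def t_def)
  also have "\<dots> = A ! (s - t - hd B)"
    using * by (auto simp: part_def s_def t_def)
  finally show "rank2 m xs = data_rank (A, B, C)"
    unfolding rank2_def Let_def s t b C data_rank_def selected_sum_def by (simp add: s_def t_def)
qed

text \<open>The Durfee heights give back the lengths, and \<open>alpha\<close>, \<open>beta\<close>,
  \<open>gamma\<close> give back the entries.\<close>

lemma inj_on_assemble: "inj_on (assemble m) (durfee_data m)"
proof (rule inj_onI)
  fix T T' assume TT': "T \<in> durfee_data m" "T' \<in> durfee_data m" "assemble m T = assemble m T'"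
  obtain A B C A' B' C' where T_eq: "T = (A, B, C)" "T' = (A', B', C')" by (cases T, cases T')
  have T: "(A, B, C) \<in> durfee_data m" "(A', B', C') \<in> durfee_data m"
    and eq: "assemble m (A, B, C) = assemble m (A', B', C')"
    using TT' by (simp_all add: T_eq)
  note p = assemble_props[OF T(1)] and p' = assemble_props[OF T(2)]
  have len: "length A = length A'" "length B = length B'" using p p' eq by metis+
  have "part A i = part A' i" if "i \<in> {1..length A}" for i
    using p(5)[of i] p'(5)[of i] eq that len by simp
  then have "A ! i = A' ! i" if "i < length A" for i
    using that len by (force simp: part_def dest: bspec[of _ _ "Suc i"])
  then have "A = A'" using len by (simp add: nth_equalityI)
  have "part B i = part B' i" if "i \<in> {1..length B}" for i
    using p(6)[of i] p'(6)[of i] eq that len by simp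
  then have "B ! i = B' ! i" if "i < length B" for i
    using that len by (force simp: part_def)
  then have "B = B'" using len by (simp add: nth_equalityI)
  moreover have "C = C'" using p(7) p'(7) eq by metis
  ultimately show "T = T'" using \<open>A = A'\<close> by (simp add: T_eq)
qed

text \<open>The preimage consists of the values of \<open>alpha\<close> and \<open>beta\<close> on
  all rows of their rectangles, zeros included, and of \<open>gamma\<close>.\<close>

lemma assemble_surj:
  assumes "rank_defined m xs"
  shows "\<exists>T \<in> durfee_data m. assemble m T = xs"
proof -
  have p: "is_partition xs" using assms by (simp add: rank_defined_def)
  define s t where "s = durfee1 m xs" and "t = durfee2 m xs"
  have "\<exists>h. rectangle_fits m xs s h"
    using durfee_rectangles_exist[OF p, of m] assms by (simp add: s_def)
  then obtain h where h: "rectangle_fits m xs s h" ..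
  have t: "rectangle_fits m xs s t" "\<And>h. rectangle_fits m xs s h \<Longrightarrow> h \<le> t"
    unfolding t_def durfee2_def s_def[symmetric]
    using rectangle_fits_Greatest[OF p h] by auto
  note exact = rank_subtractions_exact[OF assms, folded s_def t_def]
  have t1: "1 \<le> t" using t(1) by (simp add: rectangle_fits_def)
  \<comment> \<open>A rectangle of height \<open>t + 1\<close> does not fit below the first
    one.\<close>
  have below: "part xs (s + t + 1) \<le> t - m"
    using t(2)[of "t + 1"] exact(2) by (force simp: rectangle_fits_iff[OF p])
  define A B C where "A = map (alpha m xs) [1..<Suc s]" and "B = map (beta m xs) [1..<Suc t]"
    and "C = gamma m xs"
  have len: "length A = s" "length B = t" by (simp_all add: A_def B_def C_def)
  have pA: "part A i = part xs i - (s - m)" if "i \<in> {1..s}" for i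
    using that by (auto simp: part_def A_def B_def C_def alpha_def s_def t_def nth_append simp del: upt_Suc)
  have pB: "part B i = part xs (s + i) - (t - m)" if "i \<in> {1..t}" for i
    using that by (auto simp: part_def A_def B_def C_def beta_def s_def t_def nth_append simp del: upt_Suc)
  have C: "C = drop (s + t) xs" by (simp add: A_def B_def C_def gamma_def s_def t_def)
  have "sorted_wrt (\<ge>) A"
    unfolding sorted_wrt_iff_nth_less len
    using part_antimono[OF p] by (auto simp: A_def B_def C_def alpha_def Let_def diff_le_mono simp del: upt_Suc)
  moreover have "sorted_wrt (\<ge>) B"
    unfolding sorted_wrt_iff_nth_less len
    using part_antimono[OF p] by (auto simp: A_def B_def C_def beta_def Let_def s_def[symmetric] t_def[symmetric] diff_le_mono simp del: upt_Suc)
  moreover have pC: "is_partition C"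
    using p unfolding C is_partition_def by (auto simp: sorted_wrt_drop dest: in_set_dropD)
  moreover have "hd B = beta m xs 1" using t1 by (simp add: A_def B_def C_def hd_map hd_upt del: upt_Suc)
  moreover have "x + m \<le> t" if "x \<in> set C" for x
  proof -
    have "x \<le> hd C" using sorted_hd_ge that pC by (auto simp: is_partition_def)
    also have "\<dots> = part xs (s + t + 1)"
      using that part_hd[of C] part_drop[of 1 "s + t" xs] by (cases "C = []") (simp_all add: C)
    finally show ?thesis using below exact(2) by linarith
  qed
  ultimately have T: "(A, B, C) \<in> durfee_data m"
    using exact(2,5) t1 by (auto simp: durfee_data_def len)
  moreover have "assemble m (A, B, C) = xs"
  proof (rule partition_eqI[OF assemble_props(1)[OF T] p])
    fix i :: nat assume i: "1 \<le> i"
    have "part (assemble m (A, B, C)) i = part (stack m (A, B, C)) i"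
      unfolding assemble_def by (intro part_filter_pos sorted_stack[OF T])
    also have "\<dots> = part xs i"
    proof -
      consider "i \<le> s" | j where "i = s + j" "j \<in> {1..t}" | j where "i = s + t + j" "1 \<le> j"
        using i by (metis Suc_eq_plus1 add.assoc atLeastAtMost_iff le_Suc_ex not_less_eq_eq plus_1_eq_Suc le_add1)
      then show ?thesis
      proof cases
        case 1
        then show ?thesis
          using i pA[of i] exact(3)[of i] by (simp add: stack_def part_append part_map len)
      next
        case 2
        then show ?thesis
          using pB[of j] exact(4)[of j] by (simp add: stack_def part_append part_map len)
      next
        case 3
        then show ?thesis by (simp add: stack_def part_append len C part_drop)
      qed
    qed
    finally show "part (assemble m (A, B, C)) i = part xs i" .
  qed
  ultimately show ?thesis by blast
qed

text \<open>The predicate is left open because the rank is later bounded from above for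
  \<open>m\<close> and from below for \<open>m + 2\<close>.\<close>

lemma card_rank_eq_card_data:
  "card {xs \<in> partitions_of n. rank_defined m xs \<and> P (rank2 m xs)} =
   card {T \<in> durfee_data m. data_weight m T = n \<and> P (data_rank T)}"
proof -
  have "{xs \<in> partitions_of n. rank_defined m xs \<and> P (rank2 m xs)} =
    assemble m ` {T \<in> durfee_data m. data_weight m T = n \<and> P (data_rank T)}" (is "?L = ?R")
  proof (intro subset_antisym subsetI)
    fix xs assume xs: "xs \<in> ?L"
    then obtain A B C where "(A, B, C) \<in> durfee_data m" "xs = assemble m (A, B, C)"
      using assemble_surj[of m xs] by auto
    then show "xs \<in> ?R"
      using assemble_props(8,9)[of A B C m] xs by (auto simp: partitions_of_def intro!: image_eqI[of _ _ "(A, B, C)"])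
  next
    fix xs assume "xs \<in> ?R"
    then obtain A B C where "(A, B, C) \<in> durfee_data m" "xs = assemble m (A, B, C)"
      "data_weight m (A, B, C) = n" "P (data_rank (A, B, C))"
      by auto
    then show "xs \<in> ?L"
      using assemble_props[of A B C m] by (simp add: partitions_of_def)
  qed
  then show ?thesis
    by (metis (no_types, lifting) card_image inj_on_assemble inj_on_subset mem_Collect_eq subsetI)
qed

section \<open>Selecting and inserting parts\<close>

lemma sorted_take_drop:
  assumes "sorted_wrt R xs"
  shows "sorted_wrt R (take i xs @ drop (Suc i) xs)"
proof -
  have "\<forall>x\<in>set (take (Suc i) xs). \<forall>y\<in>set (drop (Suc i) xs). R x y"
    using assms sorted_wrt_append[of R "take (Suc i) xs" "drop (Suc i) xs"] by simp
  moreover have "set (take i xs) \<subseteq> set (take (Suc i) xs)"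
    by (rule set_take_subset_set_take) simp
  ultimately show ?thesis
    by (auto simp: sorted_wrt_append sorted_wrt_take sorted_wrt_drop assms)
qed

lemma sum_list_take_drop:
  fixes xs :: "nat list"
  assumes "i < length xs"
  shows "sum_list (take i xs @ drop (Suc i) xs) + xs ! i = sum_list xs"
  by (subst (3) id_take_nth_drop[OF assms]) simp

text \<open>The entry \<open>xs ! i\<close> stands after the inserted \<open>c\<close> and before
  the inserted \<open>d\<close>, so it separates them.\<close>

lemma sorted_insert_unique:
  fixes xs :: "nat list"
  assumes "sorted_wrt (\<ge>) (take i xs @ c # drop i xs)" "sorted_wrt (\<ge>) (take j xs @ d # drop j xs)"
    and "i < j" "j \<le> length xs"
  shows "d \<le> c"
proof -
  have "xs ! i \<in> set (drop i xs)"
    using assms(3,4) by (metis Cons_nth_drop_Suc list.set_intros(1) order_less_le_trans)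
  then have "xs ! i \<le> c" using assms(1) by (auto simp: sorted_wrt_append)
  moreover have "xs ! i \<in> set (take j xs)"
    using assms(3,4) by (auto simp: in_set_conv_nth intro!: exI[of _ i])
  then have "d \<le> xs ! i" using assms(2) by (auto simp: sorted_wrt_append)
  ultimately show ?thesis by simp
qed

text \<open>Padding \<open>C\<close> with zeros to length \<open>selected_sum A B + r\<close> before
  adding 1 everywhere is the insertion of a first column of that height. It requires
  \<open>length C\<close> not to exceed this height, that is, rank at least
  \<open>- int r\<close>.\<close>

definition shift_rank :: "nat \<Rightarrow> nat list \<times> nat list \<times> nat list \<Rightarrow> nat list \<times> nat list \<times> nat list" where
  "shift_rank r = (\<lambda>(A, B, C). let i = length A - length B - hd B in
     (take i A @ drop (Suc i) A, tl B,
      map Suc (C @ replicate (selected_sum A B + r - length C) 0)))"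

text \<open>The selected sum moves from \<open>A\<close> and \<open>B\<close> into the new column,
  which contributes \<open>r\<close> more, and each rectangle gains area \<open>m + 1\<close>. The
  new rank is at most \<open>- int r\<close> because the new selected sum is at most the old
  one.\<close>

lemma shift_rank_props:
  assumes T: "T \<in> durfee_data (m + 2)" and rank: "- int r \<le> data_rank T"
  shows "shift_rank r T \<in> durfee_data m"
    and "data_weight m (shift_rank r T) = data_weight (m + 2) T + (r + 2 * m + 2)"
    and "data_rank (shift_rank r T) \<le> - int r"
proof -
  obtain A B C where T_eq: "T = (A, B, C)" by (cases T)
  define s t b i a where "s = length A" and "t = length B" and "b = hd B" and "i = s - t - b"
    and "a = selected_sum A B"
  have *: "sorted_wrt (\<ge>) A" "sorted_wrt (\<ge>) B" "is_partition C"
    "m + 2 \<le> t" "t + b \<le> s" "\<And>x. x \<in> set C \<Longrightarrow> x + (m + 2) \<le> t"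
    using T unfolding T_eq durfee_data_def mem_Collect_eq prod.case s_def t_def b_def by auto
  have C: "length C \<le> a + r"
    using rank by (simp add: T_eq data_rank_def a_def)
  have a: "a = b + A ! i"
    by (simp add: a_def selected_sum_def b_def i_def s_def t_def)
  have i: "i < s" using * by (simp add: i_def)
  define A' B' C' where "A' = take i A @ drop (Suc i) A" and "B' = tl B"
    and "C' = map Suc (C @ replicate (a + r - length C) 0)"
  have shift: "shift_rank r T = (A', B', C')"
    by (simp add: shift_rank_def Let_def T_eq A'_def B'_def C'_def i_def a_def b_def s_def t_def)
  have len: "length A' = s - 1" "length B' = t - 1" "length C' = a + r"
    using i C by (auto simp: A'_def B'_def C'_def s_def t_def)
  have B_Cons: "B = b # B'" using *(4) by (cases B) (auto simp: t_def b_def B'_def)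
  have "B' \<noteq> []" using len *(4) by auto
  then have hdB': "hd B' \<le> b" using *(2) by (simp add: B_Cons)
  have "sorted_wrt (\<ge>) (replicate k (Suc 0))" for k
    by (simp add: sorted_wrt_iff_nth_less)
  then have "sorted_wrt (\<ge>) C'"
    using *(3) by (auto simp: C'_def sorted_wrt_map sorted_wrt_append is_partition_def)
  moreover have "x + m \<le> t - 1" if "x \<in> set C'" for x
    using that *(4,6) by (fastforce simp: C'_def)
  moreover have "\<forall>x\<in>set C'. 0 < x" by (auto simp: C'_def)
  ultimately show "shift_rank r T \<in> durfee_data m"
    using *(1,2,4,5) hdB' sorted_take_drop[OF *(1), of i]
    unfolding shift durfee_data_def mem_Collect_eq prod.case len is_partition_def A'_def[symmetric]
    by (auto simp: B_Cons)
  have "sum_list A' + A ! i = sum_list A"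
    unfolding A'_def using sum_list_take_drop[of i A] i by (simp add: s_def)
  moreover have "sum_list B' + b = sum_list B" by (simp add: B_Cons)
  moreover have sum_C': "sum_list C' = sum_list C + (a + r)"
  proof -
    have "sum_list (map Suc D) = sum_list D + length D" for D by (induction D) auto
    then show ?thesis using C by (simp add: C'_def sum_list_replicate)
  qed
  \<comment> \<open>The passage from \<open>u\<close> by \<open>u - (m + 2)\<close> to a rectangle
    one row shorter and one column wider.\<close>
  have area: "(u - 1) * (u - 1 - m) = u * (u - (m + 2)) + (m + 1)" if u: "m + 2 \<le> u" for u
  proof -
    obtain k where "u = m + 2 + k" using le_Suc_ex[OF u] by blast
    then show ?thesis by (simp add: algebra_simps)
  qed
  have "m + 2 \<le> s" using *(4,5) by simp
  moreover note area[OF this] area[OF *(4)]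
  ultimately have "data_weight m (A', B', C') = data_weight (m + 2) (A, B, C) + (r + 2 * m + 2)"
    using sum_C' unfolding data_weight_def prod.case len s_def[symmetric] t_def[symmetric] a by linarith
  then show "data_weight m (shift_rank r T) = data_weight (m + 2) T + (r + 2 * m + 2)"
    unfolding shift unfolding T_eq .
  \<comment> \<open>The position selected in \<open>A'\<close>. It is not before the deleted
    position \<open>i\<close>, so it holds an entry that stood after \<open>A ! i\<close>.\<close>
  define j where "j = s - t - hd B'"
  have j: "i \<le> j" "j < length A'" using hdB' *(4,5) len(1) by (auto simp: i_def j_def)
  have "selected_sum A' B' = hd B' + A' ! j"
    using *(4,5) by (simp add: selected_sum_def len j_def)
  also have "A' ! j = A ! Suc j"
    using j i len by (auto simp: A'_def nth_append s_def min_def)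
  also have "A ! Suc j \<le> A ! i"
    using *(1) j len(1) by (auto simp: sorted_wrt_iff_nth_less s_def)
  finally have "selected_sum A' B' \<le> a" using hdB' a by linarith
  then show "data_rank (shift_rank r T) \<le> - int r"
    by (simp add: shift data_rank_def len)
qed

section \<open>Inverting the deletion\<close>

lemma insert_take_drop:
  "i < length xs \<Longrightarrow> ys = take i xs @ drop (Suc i) xs \<Longrightarrow> take i ys @ (xs ! i) # drop i ys = xs"
  by (simp add: id_take_nth_drop[symmetric])

lemma filter_pos_pred_map_Suc:
  assumes "is_partition C"
  shows "filter ((<) 0) (map (\<lambda>x. x - 1) (map Suc (C @ replicate k 0))) = C"
proof -
  have "map (\<lambda>x. x - 1) (map Suc D) = D" for D by (induction D) auto
  then show ?thesis by (simp only: filter_pos_append_replicate_zero[OF assms])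
qed

text \<open>The image determines \<open>C\<close> and the sum of the deleted parts, hence everything
  except the position \<open>i\<close>. With this sum fixed, the part \<open>c\<close> inserted at
  \<open>i\<close> grows strictly with \<open>i\<close>, whereas sortedness forbids a larger part at
  a later position.\<close>

lemma inj_on_shift_rank:
  "inj_on (shift_rank r) {T \<in> durfee_data (m + 2). - int r \<le> data_rank T}"
proof (rule inj_onI)
  fix T1 T2
  assume T1: "T1 \<in> {T \<in> durfee_data (m + 2). - int r \<le> data_rank T}"
    and T2: "T2 \<in> {T \<in> durfee_data (m + 2). - int r \<le> data_rank T}"
    and eq: "shift_rank r T1 = shift_rank r T2"
  obtain A' B' C' where S: "shift_rank r T1 = (A', B', C')" by (cases "shift_rank r T1")
  \<comment> \<open>Both lengths drop by one, so \<open>p\<close> is also the difference before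
    deletion and \<open>hd B = p - i\<close>. The equation for \<open>length C'\<close> then
    expresses \<open>c\<close> through \<open>i\<close>.\<close>
  have recover: "\<exists>i. i \<le> p \<and> p \<le> length A' \<and> length C' + i = c + p + r \<and> A = take i A' @ c # drop i A' \<and>
      B = (p - i) # B' \<and> C = filter ((<) 0) (map (\<lambda>x. x - 1) C')"
    if T: "(A, B, C) \<in> durfee_data (m + 2)" "- int r \<le> data_rank (A, B, C)"
      and S: "shift_rank r (A, B, C) = (A', B', C')" and p: "p = length A' - length B'"
      and c: "c = A ! (length A - length B - hd B)" for A B C p c
  proof -
    define i where "i = length A - length B - hd B"
    have *: "is_partition C" "m + 2 \<le> length B" "length B + hd B \<le> length A"
      using T by (auto simp: durfee_data_def)
    have A': "A' = take i A @ drop (Suc i) A" and B': "B' = tl B"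
      and C': "C' = map Suc (C @ replicate (selected_sum A B + r - length C) 0)"
      using S by (auto simp: shift_rank_def Let_def i_def)
    have i: "i < length A" using * by (auto simp: i_def)
    have p': "p = length A - length B"
      unfolding p A' B' using i * by auto
    have b: "hd B = p - i" and ip: "i \<le> p"
      using * by (auto simp: p' i_def)
    have c': "c = A ! i" by (simp add: c i_def)
    have "length C' = selected_sum A B + r"
      using T(2) by (simp add: C' data_rank_def)
    also have "selected_sum A B = (p - i) + c"
      by (simp add: selected_sum_def b[symmetric] c)
    finally have "length C' + i = c + p + r" using ip by simp
    moreover have "A = take i A' @ c # drop i A'"
      using insert_take_drop[OF i A'] c' by simp
    moreover have "B = (p - i) # B'"
      using *(2) b by (cases B) (auto simp: B')
    moreover have "C = filter ((<) 0) (map (\<lambda>x. x - 1) C')"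
      unfolding C' by (rule filter_pos_pred_map_Suc[OF *(1), symmetric])
    moreover have "p \<le> length A'" by (simp add: p)
    ultimately show ?thesis using ip by blast
  qed
  obtain A1 B1 C1 A2 B2 C2 where T_eq: "T1 = (A1, B1, C1)" "T2 = (A2, B2, C2)" by (cases T1, cases T2)
  define p where "p = length A' - length B'"
  obtain i1 c1 where 1: "i1 \<le> p" "p \<le> length A'" "length C' + i1 = c1 + p + r"
    "A1 = take i1 A' @ c1 # drop i1 A'" "B1 = (p - i1) # B'" "C1 = filter ((<) 0) (map (\<lambda>x. x - 1) C')"
    using recover[OF _ _ _ p_def refl, of A1 B1 C1] T1 S by (auto simp: T_eq)
  obtain i2 c2 where 2: "i2 \<le> p" "p \<le> length A'" "length C' + i2 = c2 + p + r"
    "A2 = take i2 A' @ c2 # drop i2 A'" "B2 = (p - i2) # B'" "C2 = filter ((<) 0) (map (\<lambda>x. x - 1) C')"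
    using recover[OF _ _ _ p_def refl, of A2 B2 C2] T2 S eq by (auto simp: T_eq)
  have sorted: "sorted_wrt (\<ge>) A1" "sorted_wrt (\<ge>) A2"
    using T1 T2 by (auto simp: durfee_data_def T_eq)
  have "\<not> i1 < i2"
    using sorted_insert_unique[OF sorted[unfolded 1(4) 2(4)]] 1(1-3) 2(1-3) by linarith
  moreover have "\<not> i2 < i1"
    using sorted_insert_unique[OF sorted(2,1)[unfolded 1(4) 2(4)]] 1(1-3) 2(1-3) by linarith
  ultimately have "i1 = i2" by simp
  then show "T1 = T2" using 1 2 by (simp add: T_eq)
qed

text \<open>The deleted parts must be \<open>p - i\<close> and \<open>c = a + i - p\<close> for some
  position \<open>i\<close>. The least \<open>i\<close> at which \<open>c\<close> is not smaller
  than \<open>A ! i\<close> keeps \<open>A\<close> sorted; the rank bound shows that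
  \<open>p - b\<close> is such a position, so \<open>p - i\<close> is at least \<open>b\<close> and
  can head \<open>B\<close>.\<close>

lemma shift_rank_surj:
  assumes T: "T \<in> durfee_data m" and rank: "data_rank T \<le> - int r"
    and mr: "(m > 0 \<and> r > 0) \<or> m = 0"
  shows "\<exists>T' \<in> durfee_data (m + 2). - int r \<le> data_rank T' \<and> shift_rank r T' = T"
proof -
  obtain A B C where T_eq: "T = (A, B, C)" by (cases T)
  define s t b p a where "s = length A" and "t = length B" and "b = hd B" and "p = s - t"
    and "a = length C - r"
  have *: "sorted_wrt (\<ge>) A" "sorted_wrt (\<ge>) B" "is_partition C"
    "1 \<le> t" "m \<le> t" "t + b \<le> s" "\<And>x. x \<in> set C \<Longrightarrow> x + m \<le> t"
    using T unfolding T_eq durfee_data_def mem_Collect_eq prod.case s_def t_def b_def by auto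
  have sel: "selected_sum A B = b + A ! (p - b)"
    by (simp add: selected_sum_def b_def p_def s_def t_def)
  have C: "r + selected_sum A B \<le> length C"
    using rank by (simp add: T_eq data_rank_def)
  then have a: "length C = a + r" "b + A ! (p - b) \<le> a" by (auto simp: a_def sel)
  \<comment> \<open>The new \<open>B\<close> needs \<open>m + 2\<close> entries. For
    \<open>m > 0\<close> the assumption \<open>r > 0\<close> makes \<open>C\<close> nonempty, which
    gives the second rectangle positive width.\<close>
  have t: "m + 1 \<le> t"
  proof (cases "m = 0")
    case False
    then obtain x where "x \<in> set C" "0 < x"
      using mr C *(3) by (cases C) (auto simp: is_partition_def)
    then show ?thesis using *(7)[of x] by linarith
  qed (use *(4) in simp)
  have bp: "b \<le> p" and ps: "p < s" using * by (auto simp: p_def)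
  define i where "i = (LEAST i. A ! i + p \<le> a + i)"
  have ex: "A ! (p - b) + p \<le> a + (p - b)" using a(2) bp by linarith
  have i1: "A ! i + p \<le> a + i" unfolding i_def by (rule LeastI[of "\<lambda>i. A ! i + p \<le> a + i", OF ex])
  have ipb: "i \<le> p - b" unfolding i_def by (rule Least_le[of "\<lambda>i. A ! i + p \<le> a + i", OF ex])
  \<comment> \<open>Minimality fails the inequality at \<open>i - 1\<close> strictly; as
    \<open>c\<close> changes by one per position, \<open>c\<close> is at most
    \<open>A ! (i - 1)\<close> and hence at most all earlier entries.\<close>
  have i2: "a + i \<le> A ! k + p" if "k < i" for k
  proof -
    have "\<not> A ! (i - 1) + p \<le> a + (i - 1)"
      using not_less_Least[of "i - 1" "\<lambda>i. A ! i + p \<le> a + i"] that unfolding i_def by linarith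
    moreover have "A ! (i - 1) \<le> A ! k"
      using *(1) that ipb ps by (cases "k = i - 1") (auto simp: sorted_wrt_iff_nth_less s_def)
    ultimately show ?thesis using that by linarith
  qed
  define c where "c = a + i - p"
  have c: "c + p = a + i" using i1 by (simp add: c_def)
  define A' B' C' where "A' = take i A @ c # drop i A" and "B' = (p - i) # B"
    and "C' = filter ((<) 0) (map (\<lambda>x. x - 1) C)"
  have i_less: "i < s" using ipb ps by simp
  have len: "length A' = s + 1" "length B' = t + 1"
    using i_less by (auto simp: A'_def B'_def s_def t_def)
  \<comment> \<open>Both lists grow by one, so the inserted part is exactly the one
    selected.\<close>
  have i': "length A' - length B' - hd B' = i"
    unfolding len using ipb by (simp add: B'_def p_def[symmetric])
  have "A' ! i = c" using i_less by (simp add: A'_def nth_append s_def min_def)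
  then have sel': "selected_sum A' B' = a"
    unfolding selected_sum_def i' using c ipb by (simp add: B'_def)
  have "sorted_wrt (\<ge>) A'"
  proof -
    have "sorted_wrt (\<ge>) (take i A @ drop i A)" using *(1) by simp
    moreover have "x \<le> c" if "x \<in> set (drop i A)" for x
    proof -
      have "x \<le> hd (drop i A)" using that *(1) by (intro sorted_hd_ge) (auto simp: sorted_wrt_drop)
      then show ?thesis using i1 c i_less by (simp add: hd_drop_conv_nth s_def)
    qed
    moreover have "c \<le> x" if x: "x \<in> set (take i A)" for x
    proof -
      obtain k where "k < i" "x = A ! k" using x by (auto simp: in_set_conv_nth)
      then show ?thesis using i2[of k] c by simp
    qed
    ultimately show ?thesis
      unfolding A'_def by (force simp: sorted_wrt_append)
  qed
  moreover have "sorted_wrt (\<ge>) B'"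
  proof -
    have "x \<le> p - i" if "x \<in> set B" for x
      using sorted_hd_ge[OF *(2) that] ipb bp unfolding b_def by linarith
    then show ?thesis using *(2) by (simp add: B'_def)
  qed
  moreover have "is_partition C'"
    unfolding C'_def using *(3)
    by (intro is_partition_filter_pos) (auto simp: is_partition_def sorted_wrt_iff_nth_less diff_le_mono)
  moreover have "x + (m + 2) \<le> t + 1" if "x \<in> set C'" for x
    using that *(7) by (fastforce simp: C'_def)
  moreover have "t + 1 + hd B' \<le> s + 1" using *(6) by (simp add: B'_def p_def)
  ultimately have T': "(A', B', C') \<in> durfee_data (m + 2)"
    unfolding durfee_data_def mem_Collect_eq prod.case len using t by auto
  have lenC': "length C' \<le> a + r"
    using length_filter_le[of "(<) 0" "map (\<lambda>x. x - 1) C"] a(1) by (simp add: C'_def)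
  then have "- int r \<le> data_rank (A', B', C')"
    by (simp add: data_rank_def sel')
  moreover have "shift_rank r (A', B', C') = T"
  proof -
    \<comment> \<open>Removing the first column loses only parts equal to 1, which stand at the end
      and are restored by the padding.\<close>
    have "map Suc (filter ((<) 0) (map (\<lambda>x. x - 1) D) @
        replicate (length D - length (filter ((<) 0) (map (\<lambda>x. x - 1) D))) 0) = D"
      if "is_partition D" for D :: "nat list"
      using that
    proof (induction D)
      case (Cons d D)
      show ?case
      proof (cases "d = 1")
        case True
        then have "\<forall>x\<in>set D. x = 1" using Cons.prems by (force simp: is_partition_def)
        then have "D = replicate (length D) 1" "filter ((<) 0) (map (\<lambda>x. x - 1) D) = []"
          by (auto simp: filter_empty_conv intro: replicate_eqI)
        then show ?thesis using True by (simp add: map_replicate)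
      next
        case False
        then show ?thesis using Cons by (auto simp: is_partition_def)
      qed
    qed simp
    from this[OF *(3)] have "map Suc (C' @ replicate (a + r - length C') 0) = C"
      unfolding C'_def a(1)[symmetric] .
    moreover have "take i A' @ drop (Suc i) A' = A" using i_less by (simp add: A'_def s_def)
    ultimately show ?thesis
      unfolding shift_rank_def prod.case Let_def i' sel' T_eq by (simp add: B'_def)
  qed
  ultimately show ?thesis using T' by blast
qed

lemma card_shift_rank:
  assumes "(m > 0 \<and> r > 0) \<or> m = 0"
  shows "card {T \<in> durfee_data (m + 2). data_weight (m + 2) T = n \<and> - int r \<le> data_rank T} =
    card {T \<in> durfee_data m. data_weight m T = n + (r + 2 * m + 2) \<and> data_rank T \<le> - int r}"
    (is "card ?V = card ?U")
proof (rule bij_betw_same_card[of "shift_rank r"], rule bij_betw_imageI)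
  show "inj_on (shift_rank r) ?V"
    by (rule inj_on_subset[OF inj_on_shift_rank[of r m]]) auto
  show "shift_rank r ` ?V = ?U"
  proof (intro subset_antisym subsetI)
    fix T assume "T \<in> shift_rank r ` ?V"
    then show "T \<in> ?U" using shift_rank_props by auto
  next
    fix T assume T: "T \<in> ?U"
    then obtain T' where T': "T' \<in> durfee_data (m + 2)" "- int r \<le> data_rank T'" "shift_rank r T' = T"
      using shift_rank_surj[of T m r] assms by auto
    then show "T \<in> shift_rank r ` ?V"
      using T shift_rank_props(2)[OF T'(1,2)] by auto
  qed
qed

section \<open>The recursion for the generating function\<close>

text \<open>For \<open>m + 2 > 0\<close> every partition has a rank, which is either at least
  \<open>- int r\<close> or at most \<open>- int (r + 1)\<close>. The first kind is counted by the
  bijection.\<close>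

lemma h_le_recursion:
  assumes "(m > 0 \<and> r > 0) \<or> m = 0"
  shows "h_le (n + (r + 2 * m + 2)) m (- int r) + h_le n (m + 2) (- int (r + 1)) = card (partitions_of n)"
proof -
  have "h_le (n + (r + 2 * m + 2)) m (- int r) =
      card {xs \<in> partitions_of n. rank_defined (m + 2) xs \<and> - int r \<le> rank2 (m + 2) xs}"
    unfolding h_le_def card_rank_eq_card_data[of _ _ "\<lambda>x. x \<le> _"]
      card_rank_eq_card_data[of _ _ "\<lambda>x. _ \<le> x"] card_shift_rank[OF assms] ..
  moreover have "finite {xs \<in> partitions_of n. Q xs}" for Q
    by (rule finite_subset[OF _ finite_partitions_of[of n]]) auto
  then have "card (partitions_of n) =
      card {xs \<in> partitions_of n. rank_defined (m + 2) xs \<and> - int r \<le> rank2 (m + 2) xs} +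
      card {xs \<in> partitions_of n. rank_defined (m + 2) xs \<and> rank2 (m + 2) xs \<le> - int (r + 1)}"
    by (subst card_Un_disjoint[symmetric])
      (auto simp: partitions_of_def rank_defined_def intro!: arg_cong[of _ _ card])
  ultimately show ?thesis by (simp add: h_le_def)
qed

text \<open>Every triple of such rank is a value of \<open>shift_rank\<close>, hence has weight at
  least \<open>r + 2 * m + 2\<close>.\<close>

lemma h_le_eq_0:
  assumes "(m > 0 \<and> r > 0) \<or> m = 0" "n < r + 2 * m + 2"
  shows "h_le n m (- int r) = 0"
proof -
  have "False" if T: "T \<in> durfee_data m" "data_weight m T = n" "data_rank T \<le> - int r" for T
  proof -
    obtain T' where "T' \<in> durfee_data (m + 2)" "- int r \<le> data_rank T'" "shift_rank r T' = T"
      using shift_rank_surj[OF T(1,3) assms(1)] by blast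
    then show False using shift_rank_props(2)[of T' m r] assms(2) T(2) by simp
  qed
  then have no_data: "{T \<in> durfee_data m. data_weight m T = n \<and> data_rank T \<le> - int r} = {}"
    by blast
  show ?thesis
    unfolding h_le_def card_rank_eq_card_data[of _ _ "\<lambda>x. x \<le> _"] no_data by simp
qed

lemma H_le_recursion:
  assumes "(m > 0 \<and> r > 0) \<or> m = 0"
  shows "H_le m (- int r) = fps_X ^ (r + 2 * m + 2) *
    (Abs_fps (\<lambda>n. of_nat (card (partitions_of n))) - H_le (m + 2) (- int (r + 1)))"
proof (rule fps_ext)
  fix n
  \<comment> \<open>The coefficient at 0, set to 0 in \<open>H_le\<close>, agrees with the count
    there.\<close>
  have H: "fps_nth (H_le m' (- int r')) n = of_nat (h_le n m' (- int r'))"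
    if "(m' > 0 \<and> r' > 0) \<or> m' = 0" for m' r' n
    using h_le_eq_0[OF that, of 0] by (simp add: H_le_def)
  show "fps_nth (H_le m (- int r)) n = fps_nth (fps_X ^ (r + 2 * m + 2) *
    (Abs_fps (\<lambda>n. of_nat (card (partitions_of n))) - H_le (m + 2) (- int (r + 1)))) n"
  proof (cases "n < r + 2 * m + 2")
    case True
    then show ?thesis
      unfolding fps_X_power_mult_nth H[OF assms] h_le_eq_0[OF assms True] by simp
  next
    case False
    define k where "k = n - (r + 2 * m + 2)"
    have n: "n = k + (r + 2 * m + 2)" using False by (simp add: k_def)
    have "(of_nat (h_le n m (- int r)) :: rat) =
        of_nat (card (partitions_of k)) - of_nat (h_le k (m + 2) (- int (r + 1)))"
      unfolding h_le_recursion[OF assms, of k, symmetric] n of_nat_add by simp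
    moreover have "fps_nth (H_le (m + 2) (- int (r + 1))) k = of_nat (h_le k (m + 2) (- int (r + 1)))"
      by (rule H) simp
    ultimately show ?thesis
      unfolding fps_X_power_mult_nth H[OF assms] fps_sub_nth fps_nth_Abs_fps k_def[symmetric]
      using False by simp
  qed
qed

section \<open>Iterating the recursion\<close>

lemma exponent_Suc:
  fixes j m r :: nat
  shows "(j + 1) * r + 2 * (j + 1) * m + (j + 1) * (5 * (j + 1) - 1) div 2 =
    (j * r + 2 * j * m + j * (5 * j - 1) div 2) + ((r + j) + 2 * (m + 2 * j) + 2)"
proof -
  \<comment> \<open>The increment is even, so halving respects the sum; \<open>j = 0\<close> is
    separate because \<open>5 * j - 1\<close> truncates there.\<close>
  have "(j + 1) * (5 * (j + 1) - 1) = j * (5 * j - 1) + 2 * (5 * j + 2)"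
    by (cases j) (simp_all add: algebra_simps)
  then have "(j + 1) * (5 * (j + 1) - 1) div 2 = j * (5 * j - 1) div 2 + (5 * j + 2)"
    by simp
  then show ?thesis by (simp add: algebra_simps)
qed

theorem mainTheorem1:
  fixes m r :: nat
  assumes "(m > 0 \<and> r > 0) \<or> (m = 0 \<and> r \<ge> 0)"
  shows "H_le m (- int r) =
    (\<Prod>i. let n = i + 1 in 1 / (1 - fps_X ^ n)) *
    (\<Sum>i. let j = i + 1 in
       (-1) ^ (j - 1) * fps_X ^ (j * r + 2 * j * m + j * (5 * j - 1) div 2))"
proof -
  define P :: "rat fps" where "P = Abs_fps (\<lambda>n. of_nat (card (partitions_of n)))"
  define e where "e j = j * r + 2 * j * m + j * (5 * j - 1) div 2" for j :: nat
  define g :: "nat \<Rightarrow> rat fps" where "g i = (-1) ^ i * fps_X ^ e (i + 1)" for i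
  define H where "H N = H_le (m + 2 * N) (- int (r + N))" for N
  have e_Suc: "e (N + 1) = e N + ((r + N) + 2 * (m + 2 * N) + 2)" for N
    unfolding e_def by (rule exponent_Suc)
  have H: "H N = fps_X ^ ((r + N) + 2 * (m + 2 * N) + 2) * (P - H (N + 1))" for N
  proof -
    \<comment> \<open>From the first iteration on both parameters are positive, so the recursion
      stays applicable.\<close>
    have "(m + 2 * N > 0 \<and> r + N > 0) \<or> m + 2 * N = 0" using assms by (cases N) auto
    then show ?thesis
      unfolding H_def P_def using H_le_recursion[of "m + 2 * N" "r + N"] by (simp add: add_ac)
  qed
  have partial: "H 0 = P * (\<Sum>i<N. g i) + (-1) ^ N * fps_X ^ e N * H N" for N
  proof (induction N)
    case 0
    show ?case by (simp add: e_def)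
  next
    case (Suc N)
    define d where "d = (r + N) + 2 * (m + 2 * N) + 2"
    have X: "fps_X ^ e (N + 1) = fps_X ^ e N * (fps_X ^ d :: rat fps)"
      by (simp only: e_Suc d_def power_add)
    have HN: "H N = fps_X ^ d * (P - H (N + 1))"
      unfolding d_def by (rule H)
    have "(-1) ^ N * fps_X ^ e N * H N =
        P * g N + (-1) ^ (N + 1) * fps_X ^ e (N + 1) * H (N + 1)"
      unfolding g_def X HN by (simp add: algebra_simps)
    then show ?case using Suc by (simp add: algebra_simps)
  qed
  \<comment> \<open>Makes the remainder in \<open>partial\<close> vanish in all coefficients below
    \<open>N\<close>.\<close>
  have e_ge: "N \<le> e N" for N
    by (induction N) (use e_Suc in \<open>auto simp: le_Suc_eq\<close>)
  have g_eq: "g = (\<lambda>i. let j = i + 1 in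
      (-1) ^ (j - 1) * fps_X ^ (j * r + 2 * j * m + j * (5 * j - 1) div 2))"
    by (simp only: fun_eq_iff g_def e_def Let_def add_diff_cancel_right' simp_thms)
  have "summable g"
    unfolding g_eq by (rule summable_rank_series)
  then have "(\<lambda>N. \<Sum>i<N. g i) \<longlonglongrightarrow> suminf g"
    by (rule summable_LIMSEQ)
  then have ev: "\<forall>\<^sub>F N in sequentially. fps_nth (\<Sum>i<N. g i) k = fps_nth (suminf g) k" for k
    unfolding tendsto_fps_iff by blast
  have "H 0 = P * suminf g"
  proof (rule fps_ext)
    fix n
    \<comment> \<open>Coefficient \<open>n\<close> of the product with \<open>P\<close> involves
      only the coefficients up to \<open>n\<close> of the sum, so one \<open>N\<close> serves for
      all of them.\<close>
    have "\<forall>\<^sub>F N in sequentially. \<forall>k\<in>{..n}. fps_nth (\<Sum>i<N. g i) k = fps_nth (suminf g) k"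
      by (intro eventually_ball_finite ballI ev) simp
    then have "\<forall>\<^sub>F N in sequentially. n < N \<and> (\<forall>k\<in>{..n}. fps_nth (\<Sum>i<N. g i) k = fps_nth (suminf g) k)"
      using eventually_gt_at_top[of n] by (rule eventually_conj[rotated])
    then obtain N where N: "n < N" "\<And>k. k \<le> n \<Longrightarrow> fps_nth (\<Sum>i<N. g i) k = fps_nth (suminf g) k"
      unfolding eventually_sequentially by auto
    have "fps_nth (fps_X ^ e N * ((-1) ^ N * H N)) n = 0"
      unfolding fps_X_power_mult_nth using N(1) e_ge[of N] by simp
    then have "fps_nth (H 0) n = fps_nth (P * (\<Sum>i<N. g i)) n"
      unfolding partial[of N] by (simp add: mult_ac)
    also have "\<dots> = fps_nth (P * suminf g) n"
      unfolding fps_mult_nth using N(2) by (intro sum.cong) auto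
    finally show "fps_nth (H 0) n = fps_nth (P * suminf g) n" .
  qed
  then show ?thesis
    unfolding euler_partition_product P_def[symmetric] g_eq[symmetric] by (simp add: H_def)
qed

end
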